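(* Let $D$ be a division ring with center $F$, and let $p\in F\langle\mathcal X\rangle$. Assume that $F$ is infinite and that $p=p_1p_2$, where $p_1,p_2\in F\langle\mathcal X\rangle$ are multilinear polynomials in disjoint sets of variables such that $p_1(\mathrm{M}_\infty(F))\ne\{0\}$ and $p_2(\mathrm{M}_\infty(F))\neq\{0\}$. Then $$p(\mathrm{M}_\infty(D))=\mathrm{M}_\infty(D).$$
   Context: $F\langle\mathcal X\rangle$ is the free associative $F$-algebra on noncommuting variables $\mathcal X=\{x_1,x_2,\dots\}$. A polynomial is multilinear (in $m\ge1$ variables) if, up to naming of its $m$ distinct variables, it has the form $\sum_{\sigma\in S_m}\lambda_\sigma x_{\sigma(1)}\cdots x_{\sigma(m)}$ with $\lambda_\sigma\in F$. For an $F$-algebra $\mathcal A$ and a polynomial $p$ in $m$ variables, $p(\mathcal A)=\{p(a_1,\dots,a_m)\mid a_i\in\mathcal A\}$. For a division ring $D$ (in particular a field), $\mathrm{M}_\infty(D)=\bigcup_{n\ge1}\mathrm{M}_n(D)$ is the finitary matrix algebra: the union of the chain in which $\mathrm{M}_n(D)$ is embedded in $\mathrm{M}_{n+1}(D)$ by appending a zero row and a zero column; equivalently, countably infinite matrices with only finitely many nonzero entries. *)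

theory Defs
  imports "HOL-Library.Poly_Mapping" "HOL-Combinatorics.Permutations"
begin

section \<open>The free algebra over the center of a division ring\<close>

definition center :: "'a::ring set" where
  "center = {c. \<forall>x. c * x = x * c}"

text \<open>
  Words in the noncommuting variables, which are indexed by \<^typ>\<open>nat\<close>. Concatenation is written
  additively because the convolution product on \<^type>\<open>poly_mapping\<close> is taken over an additive
  (here noncommutative) monoid of keys.
\<close>

datatype ncword = Word (letters: "nat list")

instantiation ncword :: monoid_add
begin

definition zero_ncword :: ncword where "0 = Word []"

definition plus_ncword :: "ncword \<Rightarrow> ncword \<Rightarrow> ncword" where
  "u + v = Word (letters u @ letters v)"

instance
  by standard (simp_all add: zero_ncword_def plus_ncword_def)

end

text \<open>
  For a division ring \<open>D\<close>, the type below with its ring structure is \<open>D\<langle>X\<rangle>\<close>, in which the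
  coefficients commute with the variables. With \<open>F\<close> the center of \<open>D\<close>, the free algebra
  \<open>F\<langle>X\<rangle>\<close> is the subring of elements all of whose coefficients lie in \<open>F\<close>.
\<close>

type_synonym 'a ncpoly = "ncword \<Rightarrow>\<^sub>0 'a"

definition free_algebra :: "'a::division_ring ncpoly set" where
  "free_algebra = {p. \<forall>w. Poly_Mapping.lookup p w \<in> center}"

definition multilinear_in :: "nat list \<Rightarrow> 'a::division_ring ncpoly \<Rightarrow> bool" where
  "multilinear_in xs p \<longleftrightarrow> xs \<noteq> [] \<and> distinct xs \<and>
     (\<exists>c. (\<forall>\<sigma>. c \<sigma> \<in> center) \<and>
          p = (\<Sum>\<sigma> | \<sigma> permutes {..<length xs}.
                 Poly_Mapping.single (Word (permute_list \<sigma> xs)) (c \<sigma>)))"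


section \<open>Finitary matrices\<close>

typedef (overloaded) 'a finmat =
  "{A :: nat \<Rightarrow> nat \<Rightarrow> 'a::zero. finite {(i, j). A i j \<noteq> 0}}"
  morphisms entry Abs_finmat
  by (rule exI[of _ "\<lambda>_ _. 0"]) simp

setup_lifting type_definition_finmat

lemma finitary_iff_bounded:
  "finite {(i, j). A i j \<noteq> 0} \<longleftrightarrow> (\<exists>n. \<forall>i j. n \<le> i \<or> n \<le> j \<longrightarrow> A i j = 0)"
  for A :: "nat \<Rightarrow> nat \<Rightarrow> 'a::zero"
proof
  assume "finite {(i, j). A i j \<noteq> 0}"
  then have "finite (fst ` {(i, j). A i j \<noteq> 0} \<union> snd ` {(i, j). A i j \<noteq> 0})" by simp
  then obtain n where n: "\<forall>k \<in> fst ` {(i, j). A i j \<noteq> 0} \<union> snd ` {(i, j). A i j \<noteq> 0}. k < n"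
    using finite_nat_set_iff_bounded by blast
  have "i < n \<and> j < n" if "A i j \<noteq> 0" for i j
    using n that by (force simp: image_iff)
  then have "\<forall>i j. n \<le> i \<or> n \<le> j \<longrightarrow> A i j = 0" by (meson not_le)
  then show "\<exists>n. \<forall>i j. n \<le> i \<or> n \<le> j \<longrightarrow> A i j = 0" ..
next
  assume "\<exists>n. \<forall>i j. n \<le> i \<or> n \<le> j \<longrightarrow> A i j = 0"
  then obtain n where "\<And>i j. n \<le> i \<or> n \<le> j \<Longrightarrow> A i j = 0" by blast
  then have "{(i, j). A i j \<noteq> 0} \<subseteq> {..<n} \<times> {..<n}"
    by (auto simp: not_le[symmetric])
  then show "finite {(i, j). A i j \<noteq> 0}" by (rule finite_subset) simp
qed

lemma entry_bounded:
  obtains n where "\<And>i j. n \<le> i \<or> n \<le> j \<Longrightarrow> entry A i j = 0"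
  using entry[of A] unfolding mem_Collect_eq finitary_iff_bounded by blast

lemma finmat_eqI: "A = B" if "\<And>i j. entry A i j = entry B i j"
  using that by (metis entry_inject ext)

instantiation finmat :: (ab_group_add) ab_group_add
begin

lift_definition zero_finmat :: "'a finmat" is "\<lambda>_ _. 0" by simp

lift_definition plus_finmat :: "'a finmat \<Rightarrow> 'a finmat \<Rightarrow> 'a finmat" is
  "\<lambda>A B i j. A i j + B i j"
  subgoal for A B
    by (rule finite_subset[of _ "{(i, j). A i j \<noteq> 0} \<union> {(i, j). B i j \<noteq> 0}"]) auto
  done

lift_definition minus_finmat :: "'a finmat \<Rightarrow> 'a finmat \<Rightarrow> 'a finmat" is
  "\<lambda>A B i j. A i j - B i j"
  subgoal for A B
    by (rule finite_subset[of _ "{(i, j). A i j \<noteq> 0} \<union> {(i, j). B i j \<noteq> 0}"]) auto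
  done

lift_definition uminus_finmat :: "'a finmat \<Rightarrow> 'a finmat" is "\<lambda>A i j. - A i j" by simp

instance
  by standard (transfer, simp add: fun_eq_iff algebra_simps)+

end

instantiation finmat :: (ring) ring
begin

lift_definition times_finmat :: "'a finmat \<Rightarrow> 'a finmat \<Rightarrow> 'a finmat" is
  "\<lambda>A B i k. Sum_any (\<lambda>j. A i j * B j k)"
proof -
  fix A B :: "nat \<Rightarrow> nat \<Rightarrow> 'a"
  assume "finite {(i, j). A i j \<noteq> 0}" "finite {(i, j). B i j \<noteq> 0}"
  then obtain m n where m: "\<And>i j. m \<le> i \<or> m \<le> j \<Longrightarrow> A i j = 0"
    and n: "\<And>i j. n \<le> i \<or> n \<le> j \<Longrightarrow> B i j = 0"
    unfolding finitary_iff_bounded by blast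
  have "\<forall>i k. max m n \<le> i \<or> max m n \<le> k \<longrightarrow> Sum_any (\<lambda>j. A i j * B j k) = 0"
    using m n by auto
  then show "finite {(i, k). Sum_any (\<lambda>j. A i j * B j k) \<noteq> 0}"
    unfolding finitary_iff_bounded by blast
qed

lemma entry_times_bounded:
  assumes "\<And>i j. n \<le> i \<or> n \<le> j \<Longrightarrow> entry A i j = 0"
  shows "entry (A * B) i k = (\<Sum>j<n. entry A i j * entry B j k)"
proof -
  have "{j. entry A i j * entry B j k \<noteq> 0} \<subseteq> {..<n}"
    using assms by (force simp: not_le[symmetric])
  then show ?thesis
    unfolding times_finmat.rep_eq by (simp add: Sum_any.expand_superset)
qed

instance
proof
  fix A B C :: "'a finmat"
  obtain n where n: "\<And>i j. n \<le> i \<or> n \<le> j \<Longrightarrow> entry A i j = 0"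
    using entry_bounded by blast
  obtain m where m: "\<And>i j. m \<le> i \<or> m \<le> j \<Longrightarrow> entry B i j = 0"
    using entry_bounded by blast
  define k where "k = max n m"
  have A: "\<And>i j. k \<le> i \<or> k \<le> j \<Longrightarrow> entry A i j = 0"
    and B: "\<And>i j. k \<le> i \<or> k \<le> j \<Longrightarrow> entry B i j = 0"
    using n m by (auto simp: k_def)
  have AB: "\<And>i j. k \<le> i \<or> k \<le> j \<Longrightarrow> entry (A * B) i j = 0"
    using A B by (auto simp: entry_times_bounded[OF A])
  have ABp: "\<And>i j. k \<le> i \<or> k \<le> j \<Longrightarrow> entry (A + B) i j = 0"
    using A B by (simp add: plus_finmat.rep_eq)
  show "A * B * C = A * (B * C)"
  proof (rule finmat_eqI)
    fix i l
    have "entry (A * B * C) i l =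
        (\<Sum>j<k. \<Sum>h<k. entry A i h * entry B h j * entry C j l)"
      by (simp add: entry_times_bounded[OF AB] entry_times_bounded[OF A] sum_distrib_right)
    also have "\<dots> = (\<Sum>h<k. \<Sum>j<k. entry A i h * entry B h j * entry C j l)"
      by (rule sum.swap)
    also have "\<dots> = entry (A * (B * C)) i l"
      by (simp add: entry_times_bounded[OF A] entry_times_bounded[OF B] sum_distrib_left
          mult.assoc)
    finally show "entry (A * B * C) i l = entry (A * (B * C)) i l" .
  qed
  show "(A + B) * C = A * C + B * C"
    by (rule finmat_eqI)
      (simp add: plus_finmat.rep_eq entry_times_bounded[OF ABp] entry_times_bounded[OF A]
        entry_times_bounded[OF B] distrib_right sum.distrib)
  show "A * (B + C) = A * B + A * C"
    by (rule finmat_eqI)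
      (simp add: plus_finmat.rep_eq entry_times_bounded[OF A] distrib_left sum.distrib)
qed

end

lift_definition scale_finmat :: "'a::ring \<Rightarrow> 'a finmat \<Rightarrow> 'a finmat" is
  "\<lambda>c A i j. c * A i j"
  subgoal for c A by (rule finite_subset[of _ "{(i, j). A i j \<noteq> 0}"]) auto
  done

text \<open>
  With \<open>K\<close> a subring of \<open>D\<close>, this is \<open>M\<^sub>\<infinity>(K)\<close> as a subset of \<open>M\<^sub>\<infinity>(D)\<close>.
\<close>

definition finmats_over :: "'a::ring set \<Rightarrow> 'a finmat set" where
  "finmats_over K = {A. \<forall>i j. entry A i j \<in> K}"


section \<open>Evaluation of noncommutative polynomials at finitary matrices\<close>

text \<open>
  The ring of finitary matrices has no identity, so the empty word has no value there; it is sent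
  to \<open>0\<close> by convention. Only polynomials without constant term are evaluated, to which the
  convention is irrelevant.
\<close>

fun eval_letters :: "(nat \<Rightarrow> 'a::ring finmat) \<Rightarrow> nat list \<Rightarrow> 'a finmat" where
  "eval_letters a [] = 0"
| "eval_letters a [x] = a x"
| "eval_letters a (x # y # xs) = a x * eval_letters a (y # xs)"

definition eval_ncpoly :: "(nat \<Rightarrow> 'a::division_ring finmat) \<Rightarrow> 'a ncpoly \<Rightarrow> 'a finmat" where
  "eval_ncpoly a p = (\<Sum>w\<in>Poly_Mapping.keys p. scale_finmat (Poly_Mapping.lookup p w) (eval_letters a (letters w)))"

text \<open>
  The image \<open>p(S)\<close>. Values are assigned to all variables; those not occurring in \<open>p\<close> do not
  affect the result.
\<close>

definition ncpoly_image :: "'a::division_ring ncpoly \<Rightarrow> 'a finmat set \<Rightarrow> 'a finmat set" where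
  "ncpoly_image p S = {eval_ncpoly a p | a. \<forall>i. a i \<in> S}"

end

theory Submission
  imports Defs
begin

text \<open>
  Let \<open>w\<close> and \<open>u\<close> be monomials of \<open>p\<^sub>1\<close> and \<open>p\<^sub>2\<close> with nonzero coefficients and let \<open>N\<close> be the
  length of \<open>w u\<close>. Take a system of \<open>n \<times> n\<close> block matrix units \<open>T r s\<close>, where \<open>n\<close> bounds the
  support of the target \<open>A\<close>, and substitute \<open>A T 0 1, T 1 2, \<dots>, T (N - 1) 0\<close> for the consecutive
  letters of \<open>w u\<close>. A product of distinct such matrices vanishes unless the indices follow
  the cycle, so \<open>w\<close> is the only permutation of its letters with nonzero value, and likewise for
  \<open>u\<close>. Hence \<open>p\<close> takes the value \<open>A T 0 0 = A\<close>, up to the two nonzero coefficients, which are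
  absorbed in the first factor.
\<close>

section \<open>Evaluation of words and polynomials\<close>

text \<open>Both words must be nonempty: the empty word is sent to \<open>0\<close>, which is not
  neutral for multiplication.\<close>

lemma eval_letters_append:
  "v \<noteq> [] \<Longrightarrow> u \<noteq> [] \<Longrightarrow> eval_letters a (v @ u) = eval_letters a v * eval_letters a u"
proof (induction a v rule: eval_letters.induct)
  case (2 a x)
  then show ?case by (cases u) auto
qed (simp_all add: mult.assoc)

lemma scale_finmat_add_left: "scale_finmat (c + d) A = scale_finmat c A + scale_finmat d A"
  by (rule finmat_eqI) (simp add: scale_finmat.rep_eq plus_finmat.rep_eq distrib_right)

lemma scale_finmat_zero_left [simp]: "scale_finmat 0 A = 0"
  by (rule finmat_eqI) (simp add: scale_finmat.rep_eq zero_finmat.rep_eq)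

lemma scale_finmat_zero_right [simp]: "scale_finmat c 0 = 0"
  by (rule finmat_eqI) (simp add: scale_finmat.rep_eq zero_finmat.rep_eq)

text \<open>Cancellation can make the support of a sum smaller than the union of the supports.
  Summing over a common superset lets additivity be checked word by word.\<close>

lemma eval_ncpoly_superset:
  assumes "finite S" "Poly_Mapping.keys p \<subseteq> S"
  shows "eval_ncpoly a p =
    (\<Sum>w\<in>S. scale_finmat (Poly_Mapping.lookup p w) (eval_letters a (letters w)))"
  unfolding eval_ncpoly_def using assms
  by (intro sum.mono_neutral_left) (auto simp: in_keys_iff)

lemma eval_ncpoly_zero [simp]: "eval_ncpoly a 0 = 0"
  by (simp add: eval_ncpoly_def)

lemma eval_ncpoly_add: "eval_ncpoly a (p + q) = eval_ncpoly a p + eval_ncpoly a q"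
proof -
  let ?S = "Poly_Mapping.keys p \<union> Poly_Mapping.keys q"
  have "Poly_Mapping.keys (p + q) \<subseteq> ?S" by (rule Poly_Mapping.keys_add)
  then show ?thesis
    by (simp add: eval_ncpoly_superset[of ?S] lookup_add scale_finmat_add_left sum.distrib)
qed

lemma eval_ncpoly_sum: "eval_ncpoly a (\<Sum>i\<in>I. f i) = (\<Sum>i\<in>I. eval_ncpoly a (f i))"
  by (induction I rule: infinite_finite_induct) (simp_all add: eval_ncpoly_add)

lemma eval_ncpoly_single:
  "eval_ncpoly a (Poly_Mapping.single w c) = scale_finmat c (eval_letters a (letters w))"
  by (subst eval_ncpoly_superset[of "{w}"]) auto

section \<open>Words whose value vanishes\<close>

lemma permute_list_eq_imp_eq:
  assumes "distinct xs" "\<sigma> permutes {..<length xs}" "\<tau> permutes {..<length xs}"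
    and "permute_list \<sigma> xs = permute_list \<tau> xs"
  shows "\<sigma> = \<tau>"
proof
  fix i
  show "\<sigma> i = \<tau> i"
  proof (cases "i < length xs")
    case True
    then have "\<sigma> i < length xs" "\<tau> i < length xs"
      using permutes_in_image[OF assms(2), of i] permutes_in_image[OF assms(3), of i] by auto
    moreover have "xs ! \<sigma> i = xs ! \<tau> i"
      using True assms by (metis permute_list_nth)
    ultimately show ?thesis using assms(1) by (simp add: nth_eq_iff_index_eq)
  next
    case False
    then show ?thesis using assms(2,3) by (simp add: permutes_def)
  qed
qed

text \<open>Letters are added from the right. A nonzero value forces a nonzero value of the tail,
  which is thus a factor of \<open>w\<close> from some position \<open>j\<close> on, and a nonzero
  product of the first two matrices. By \<open>chain\<close> the new letter stands in
  \<open>w\<close> just before position \<open>j\<close>.\<close>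

lemma eval_letters_nonzero_imp_factor:
  assumes chain: "\<And>i j. i < length w \<Longrightarrow> j < length w \<Longrightarrow> a (w ! i) * a (w ! j) \<noteq> 0 \<Longrightarrow> j = Suc i"
    and "set v \<subseteq> set w" "v \<noteq> []" "eval_letters a v \<noteq> 0"
  shows "\<exists>i. v = take (length v) (drop i w)"
  using assms(2-)
proof (induction v rule: induct_list012)
  case (2 x)
  then obtain i where "i < length w" "x = w ! i" by (auto simp: in_set_conv_nth)
  then show ?case by (metis Cons_nth_drop_Suc One_nat_def length_Cons list.size(3) take0 take_Suc_Cons)
next
  case (3 x y v)
  then have "eval_letters a (y # v) \<noteq> 0" by auto
  with 3 obtain j where j: "y # v = take (length (y # v)) (drop j w)" by auto
  then have jl: "j < length w" by (cases "j < length w") auto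
  then have y: "y = w ! j" using j by (metis Cons_nth_drop_Suc length_Cons list.inject take_Suc_Cons)
  obtain i where i: "i < length w" "x = w ! i" using 3 by (auto simp: in_set_conv_nth)
  have "a x * a y \<noteq> 0"
  proof
    assume 0: "a x * a y = 0"
    have "eval_letters a (x # y # v) = 0"
    proof (cases v)
      case (Cons z zs)
      have "eval_letters a (x # y # v) = (a x * a y) * eval_letters a v"
        by (simp add: Cons mult.assoc)
      then show ?thesis using 0 by simp
    qed (use 0 in simp)
    then show False using 3 by simp
  qed
  then have "j = Suc i" using chain i jl y by metis
  then have "x # y # v = take (length (x # y # v)) (drop i w)"
    using i j by (metis Cons_nth_drop_Suc length_Cons take_Suc_Cons)
  then show ?case by blast
qed simp

text \<open>A factor of \<open>w\<close> that starts at \<open>i\<close> has at most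
  \<open>length w - i\<close> letters, so a rearrangement of \<open>w\<close> with nonzero value
  starts at \<open>0\<close> and is \<open>w\<close> itself.\<close>

lemma eval_letters_permuted_eq_zero:
  assumes "\<And>i j. i < length w \<Longrightarrow> j < length w \<Longrightarrow> a (w ! i) * a (w ! j) \<noteq> 0 \<Longrightarrow> j = Suc i"
    and "mset v = mset w" "v \<noteq> w"
  shows "eval_letters a v = 0"
proof (rule ccontr)
  assume nz: "eval_letters a v \<noteq> 0"
  have len: "length v = length w" and "set v = set w"
    using assms(2) by (auto dest: mset_eq_length mset_eq_setD)
  moreover from nz have "v \<noteq> []" by auto
  ultimately obtain i where i: "v = take (length v) (drop i w)"
    using eval_letters_nonzero_imp_factor[of w a v, OF assms(1)] nz by blast
  then have "length v \<le> length w - i" by (metis length_drop length_take min.cobounded1)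
  with len \<open>v \<noteq> []\<close> have "i = 0" by (cases w) auto
  with i len assms(3) show False by simp
qed

section \<open>Block matrix units\<close>

text \<open>The matrix unit at \<open>(r, s)\<close> with its entry \<open>1\<close> replaced by the
  n by n identity matrix. The guard \<open>0 < n\<close> keeps it finitary: as
  \<open>i div 0 = 0\<close> and \<open>i mod 0 = i\<close>, the case \<open>n = r = s = 0\<close>
  would give the infinite identity matrix.\<close>

lift_definition block_unit :: "nat \<Rightarrow> nat \<Rightarrow> nat \<Rightarrow> 'a::ring_1 finmat" is
  "\<lambda>n r s i j. if 0 < n \<and> i div n = r \<and> j div n = s \<and> i mod n = j mod n then 1 else 0"
proof -
  fix n r s :: nat
  have "{(i, j). 0 < n \<and> i div n = r \<and> j div n = s \<and> i mod n = j mod n}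
      \<subseteq> {..<n * Suc r} \<times> {..<n * Suc s}"
    by (auto simp: less_mult_imp_div_less dest: dividend_less_times_div)
  then show "finite {(i, j). (if 0 < n \<and> i div n = r \<and> j div n = s \<and> i mod n = j mod n
      then 1 else 0 :: 'a) \<noteq> 0}"
    by (rule finite_subset[rotated, OF finite_subset]) (auto split: if_splits)
qed

text \<open>Column \<open>j\<close> of the block unit has at most one nonzero entry, in row
  \<open>n * r + j mod n\<close>. Right multiplication thus moves block column \<open>r\<close> to
  block column \<open>s\<close> and erases all else.\<close>

lemma entry_times_block_unit:
  fixes X :: "'a::ring_1 finmat"
  assumes "0 < n"
  shows "entry (X * block_unit n r s) i j =
    (if j div n = s then entry X i (n * r + j mod n) else 0)"
proof -
  have "Sum_any (\<lambda>l. entry X i l * entry (block_unit n r s) l j) =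
      (\<Sum>l\<in>{n * r + j mod n}. entry X i l * entry (block_unit n r s) l j)"
  proof (rule Sum_any.expand_superset)
    have "l = n * r + j mod n" if "entry (block_unit n r s :: 'a finmat) l j \<noteq> 0" for l
    proof -
      have "l div n = r" "l mod n = j mod n"
        using that by (auto simp: block_unit.rep_eq split: if_splits)
      then show ?thesis using mult_div_mod_eq[of n l] by simp
    qed
    then show "{l. entry X i l * entry (block_unit n r s) l j \<noteq> 0} \<subseteq> {n * r + j mod n}"
      by force
  qed simp
  with assms show ?thesis
    by (simp add: times_finmat.rep_eq block_unit.rep_eq)
qed

lemma block_unit_times_block_unit:
  assumes "0 < n"
  shows "block_unit n r s * block_unit n r' s' = (if s = r' then block_unit n r s' else 0)"
  using assms by (intro finmat_eqI)
    (auto simp: entry_times_block_unit block_unit.rep_eq zero_finmat.rep_eq)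

lemma times_block_unit_0:
  assumes "0 < n" "\<And>i j. n \<le> j \<Longrightarrow> entry X i j = 0"
  shows "X * block_unit n 0 0 = X"
  using assms by (intro finmat_eqI) (auto simp: entry_times_block_unit div_eq_0_iff)

lemma block_unit_0_times:
  assumes "0 < n" "\<And>i j. n \<le> i \<or> n \<le> j \<Longrightarrow> entry X i j = 0"
  shows "block_unit n 0 0 * X = X"
proof (rule finmat_eqI)
  fix i j
  have "Sum_any (\<lambda>l. entry (block_unit n 0 0) i l * entry X l j) =
      (\<Sum>l\<in>{i}. entry (block_unit n 0 0) i l * entry X l j)"
    by (rule Sum_any.expand_superset)
      (auto simp: block_unit.rep_eq div_eq_0_iff split: if_splits)
  with assms show "entry (block_unit n 0 0 * X) i j = entry X i j"
    by (auto simp: times_finmat.rep_eq block_unit.rep_eq div_eq_0_iff)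
qed

section \<open>Prescribing the value of one monomial\<close>

lemma cyclic_assignment:
  fixes A :: "'a::ring_1 finmat"
  assumes "distinct z" "2 \<le> length z"
  obtains a where "eval_letters a z = A"
    and "\<And>i j. i < length z \<Longrightarrow> j < length z \<Longrightarrow> a (z ! i) * a (z ! j) \<noteq> 0 \<Longrightarrow>
      j = Suc i mod length z"
proof -
  let ?N = "length z"
  obtain n0 where n0: "\<And>i j. n0 \<le> i \<or> n0 \<le> j \<Longrightarrow> entry A i j = 0"
    using entry_bounded by blast
  \<comment> \<open>The successor makes the block size positive even when \<open>A = 0\<close> and
    \<open>n0 = 0\<close>.\<close>
  define n where "n = Suc n0"
  have n: "0 < n" and A: "\<And>i j. n \<le> i \<or> n \<le> j \<Longrightarrow> entry A i j = 0"
    using n0 by (auto simp: n_def)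
  define T where "T r s = (block_unit n r s :: 'a finmat)" for r s
  have TT: "T r s * T r' s' = (if s = r' then T r s' else 0)" for r s r' s'
    unfolding T_def by (rule block_unit_times_block_unit[OF n])
  have AT: "A * T 0 0 = A" and TA: "T 0 0 * A = A"
    unfolding T_def using n A by (auto intro: times_block_unit_0 block_unit_0_times)
  \<comment> \<open>\<open>Z i\<close> sits in block position \<open>(i, i + 1)\<close>, and the
    last one wraps around to block column \<open>0\<close>. There is no identity matrix, so
    \<open>T i i\<close> stands in for it in the letters that do not carry \<open>A\<close>.\<close>
  define Z where "Z i = (if i = 0 then A else T i i) * T i (Suc i mod ?N)" for i
  define a where "a x = Z (inv_into {..<?N} ((!) z) x)" for x
  have "inj_on ((!) z) {..<?N}"
    using assms(1) by (simp add: inj_on_nth)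
  then have a: "a (z ! i) = Z i" if "i < ?N" for i
    unfolding a_def using that by (simp add: inv_into_f_f)
  \<comment> \<open>By \<open>left\<close> and \<open>right\<close>, every product
    \<open>Z i * Z j\<close> contains the product of two diagonal block units, which is zero unless
    \<open>j\<close> is the cyclic successor of \<open>i\<close>.\<close>
  have left: "Z i = T i i * Z i" for i
    by (simp add: Z_def TT TA mult.assoc[symmetric])
  have right: "Z i = Z i * T (Suc i mod ?N) (Suc i mod ?N)" for i
    by (simp add: Z_def TT mult.assoc)
  \<comment> \<open>Past the letter that carries \<open>A\<close> the product telescopes, by
    induction from the end of the word.\<close>
  have tail: "eval_letters a (drop i z) = T i 0" if "0 < i" "i < ?N" for i
    using that
  proof (induction "?N - i" arbitrary: i rule: less_induct)
    case less
    have d: "drop i z = z ! i # drop (Suc i) z"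
      using less.prems by (simp add: Cons_nth_drop_Suc)
    show ?case
    proof (cases "Suc i = ?N")
      case True
      then show ?thesis using less.prems by (simp add: d a Z_def TT)
    next
      case False
      then have "eval_letters a (drop (Suc i) z) = T (Suc i) 0" "drop (Suc i) z \<noteq> []"
        using less.prems by (auto intro!: less.hyps)
      then show ?thesis
        using False less.prems eval_letters_append[of "[z ! i]" "drop (Suc i) z" a]
        by (simp add: d a Z_def TT)
    qed
  qed
  show ?thesis
  proof
    have "z = z ! 0 # drop 1 z"
      using assms(2) by (cases z) simp_all
    then have "eval_letters a z = a (z ! 0) * eval_letters a (drop 1 z)"
      using assms(2) eval_letters_append[of "[z ! 0]" "drop 1 z" a] by simp
    also have "\<dots> = A"
      using assms(2) by (simp only: a tail) (simp add: a tail Z_def TT AT mult.assoc)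
    finally show "eval_letters a z = A" .
  next
    fix i j
    assume "i < ?N" "j < ?N" and nz: "a (z ! i) * a (z ! j) \<noteq> 0"
    then have "a (z ! i) * a (z ! j) = Z i * (T (Suc i mod ?N) (Suc i mod ?N) * T j j) * Z j"
      using left[of j] right[of i] by (metis a mult.assoc)
    with nz show "j = Suc i mod ?N" by (auto simp: TT split: if_splits)
  qed
qed

section \<open>Nonzero coefficients and the image of the product\<close>

lemma ex_nonzero_coeff:
  assumes "p = (\<Sum>i\<in>I. Poly_Mapping.single (f i) (c i))" "ncpoly_image p (finmats_over center) \<noteq> {0}"
  obtains i where "i \<in> I" "c i \<noteq> 0"
proof -
  have "p \<noteq> 0"
  proof
    assume "p = 0"
    \<comment> \<open>The zero matrix is an admissible argument, so the image of the zero polynomial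
      is \<open>{0}\<close> and not empty.\<close>
    moreover have "(0 :: 'a finmat) \<in> finmats_over center"
      by (simp add: finmats_over_def center_def zero_finmat.rep_eq)
    ultimately have "ncpoly_image p (finmats_over center) = {0}"
      by (auto simp: ncpoly_image_def intro!: exI[of _ "\<lambda>_. 0"])
    with assms(2) show False ..
  qed
  then show ?thesis
    using that assms(1) by (metis (no_types, lifting) single_zero sum.neutral)
qed

theorem theorem35:
  fixes p p1 p2 :: "'a::division_ring ncpoly"
    and xs ys :: "nat list"
  assumes "infinite (center :: 'a set)"
    and "p \<in> free_algebra" "p1 \<in> free_algebra" "p2 \<in> free_algebra"
    and "p = p1 * p2"
    and "multilinear_in xs p1"
    and "multilinear_in ys p2"
    and "set xs \<inter> set ys = {}"
    and "ncpoly_image p1 (finmats_over center) \<noteq> {0}"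
    and "ncpoly_image p2 (finmats_over center) \<noteq> {0}"
  shows "ncpoly_image p (finmats_over UNIV) = finmats_over UNIV"
proof -
  let ?P = "{\<sigma>. \<sigma> permutes {..<length xs}}" and ?Q = "{\<tau>. \<tau> permutes {..<length ys}}"
  obtain c where xs: "xs \<noteq> []" "distinct xs"
    and p1: "p1 = (\<Sum>\<sigma>\<in>?P. Poly_Mapping.single (Word (permute_list \<sigma> xs)) (c \<sigma>))"
    using assms(6) by (auto simp: multilinear_in_def)
  obtain d where ys: "ys \<noteq> []" "distinct ys"
    and p2: "p2 = (\<Sum>\<tau>\<in>?Q. Poly_Mapping.single (Word (permute_list \<tau> ys)) (d \<tau>))"
    using assms(7) by (auto simp: multilinear_in_def)
  obtain \<sigma> where \<sigma>: "\<sigma> \<in> ?P" "c \<sigma> \<noteq> 0" using ex_nonzero_coeff[OF p1 assms(9)] by blast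
  obtain \<tau> where \<tau>: "\<tau> \<in> ?Q" "d \<tau> \<noteq> 0" using ex_nonzero_coeff[OF p2 assms(10)] by blast
  define w where "w = permute_list \<sigma> xs"
  define u where "u = permute_list \<tau> ys"
  have w: "mset w = mset xs" "set w = set xs" "distinct w" "length w = length xs"
    using \<sigma> xs by (simp_all add: w_def)
  have u: "mset u = mset ys" "set u = set ys" "distinct u" "length u = length ys"
    using \<tau> ys by (simp_all add: u_def)
  have ne: "w \<noteq> []" "u \<noteq> []" using w u xs ys by auto
  have "\<exists>a. eval_ncpoly a p = A" for A
  proof -
    \<comment> \<open>The coefficient of the only monomial that will survive. Its inverse is built
      into the prescribed value of \<open>w @ u\<close> and cancels it at the end.\<close>
    define e where "e = c \<sigma> * d \<tau>"
    have e: "e \<noteq> 0" using \<sigma> \<tau> by (simp add: e_def)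
    have "distinct (w @ u)" using w u assms(8) by simp
    moreover have "2 \<le> length (w @ u)"
      using ne by (cases w; cases u) auto
    ultimately obtain a where a: "eval_letters a (w @ u) = scale_finmat (inverse e) A"
      and cyc: "\<And>i j. i < length (w @ u) \<Longrightarrow> j < length (w @ u) \<Longrightarrow>
        a ((w @ u) ! i) * a ((w @ u) ! j) \<noteq> 0 \<Longrightarrow> j = Suc i mod length (w @ u)"
      using cyclic_assignment[of "w @ u" "scale_finmat (inverse e) A"] by blast
    have chain_w: "j = Suc i"
      if "i < length w" "j < length w" "a (w ! i) * a (w ! j) \<noteq> 0" for i j
    proof -
      \<comment> \<open>As \<open>u\<close> is nonempty, the cyclic successor of a position in
        \<open>w\<close> does not wrap around.\<close>
      have "Suc i < length (w @ u)" using that ne by (cases u) auto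
      with cyc[of i j] that show ?thesis by (simp add: nth_append)
    qed
    have chain_u: "j = Suc i"
      if "i < length u" "j < length u" "a (u ! i) * a (u ! j) \<noteq> 0" for i j
    proof -
      have "length w + j = Suc (length w + i) mod (length w + length u)"
        using cyc[of "length w + i" "length w + j"] that by simp
      \<comment> \<open>The last letter of \<open>u\<close> is followed cyclically by position
        \<open>0\<close>, which lies in the nonempty \<open>w\<close> and so is not a position of
        \<open>u\<close>.\<close>
      moreover have "Suc i \<noteq> length u"
      proof
        assume "Suc i = length u"
        then have "Suc (length w + i) = length w + length u" by simp
        with calculation ne show False by (simp only: mod_self) simp
      qed
      ultimately show ?thesis using that by simp
    qed
    \<comment> \<open>The letters are distinct, so a permutation other than \<sigma> gives a word
      other than \<open>w\<close>.\<close>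
    have zero_w: "eval_letters a (permute_list \<sigma>' xs) = 0" if "\<sigma>' \<in> ?P" "\<sigma>' \<noteq> \<sigma>" for \<sigma>'
    proof (rule eval_letters_permuted_eq_zero[OF chain_w])
      show "mset (permute_list \<sigma>' xs) = mset w" using that w by simp
      show "permute_list \<sigma>' xs \<noteq> w"
        using that \<sigma> permute_list_eq_imp_eq[OF xs(2)] unfolding w_def by blast
    qed
    have zero_u: "eval_letters a (permute_list \<tau>' ys) = 0" if "\<tau>' \<in> ?Q" "\<tau>' \<noteq> \<tau>" for \<tau>'
    proof (rule eval_letters_permuted_eq_zero[OF chain_u])
      show "mset (permute_list \<tau>' ys) = mset u" using that u by simp
      show "permute_list \<tau>' ys \<noteq> u"
        using that \<tau> permute_list_eq_imp_eq[OF ys(2)] unfolding u_def by blast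
    qed
    have app: "eval_letters a (permute_list \<sigma>' xs @ permute_list \<tau>' ys) =
        eval_letters a (permute_list \<sigma>' xs) * eval_letters a (permute_list \<tau>' ys)" for \<sigma>' \<tau>'
      using xs ys by (intro eval_letters_append) (metis length_permute_list length_0_conv)+
    have fin: "finite ?P" "finite ?Q" by (simp_all add: finite_permutations)
    have "eval_ncpoly a p = (\<Sum>\<sigma>'\<in>?P. \<Sum>\<tau>'\<in>?Q. scale_finmat (c \<sigma>' * d \<tau>')
        (eval_letters a (permute_list \<sigma>' xs) * eval_letters a (permute_list \<tau>' ys)))"
      by (simp add: assms(5) p1 p2 sum_product mult_single eval_ncpoly_sum eval_ncpoly_single
          plus_ncword_def app)
    also have "\<dots> = (\<Sum>\<sigma>'\<in>{\<sigma>}. \<Sum>\<tau>'\<in>?Q. scale_finmat (c \<sigma>' * d \<tau>')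
        (eval_letters a (permute_list \<sigma>' xs) * eval_letters a (permute_list \<tau>' ys)))"
      using \<sigma> zero_w by (intro sum.mono_neutral_right fin) auto
    also have "\<dots> = (\<Sum>\<tau>'\<in>?Q. scale_finmat (c \<sigma> * d \<tau>')
        (eval_letters a w * eval_letters a (permute_list \<tau>' ys)))"
      by (simp add: w_def)
    also have "\<dots> = (\<Sum>\<tau>'\<in>{\<tau>}. scale_finmat (c \<sigma> * d \<tau>')
        (eval_letters a w * eval_letters a (permute_list \<tau>' ys)))"
      using \<tau> zero_u by (intro sum.mono_neutral_right fin) auto
    also have "\<dots> = scale_finmat e (scale_finmat (inverse e) A)"
      using a ne by (simp add: e_def u_def eval_letters_append)
    also have "\<dots> = A"
      using e by (intro finmat_eqI) (simp add: scale_finmat.rep_eq mult.assoc[symmetric])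
    finally show ?thesis by blast
  qed
  then have "A \<in> ncpoly_image p (finmats_over UNIV)" for A
    unfolding ncpoly_image_def finmats_over_def mem_Collect_eq by (metis UNIV_I)
  then show ?thesis
    by (auto simp: finmats_over_def)
qed

end
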